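(* Let $F:\hat K\to K$ be an affine diffeomorphism between nondegenerate triangles in $\mathbb{R}^2$ with $F(\hat{\mathbf x}_i)=\mathbf x_i$ for $i=1,2,3$ and constant Jacobian matrix $J$. Let $\mathcal{F}^{\mathrm{div}}$ be the contravariant Piola map, $N$ and $\hat N$ the (ordered, 9-component) vectors of Mardal--Tai--Winther degrees of freedom on $K$ and $\hat K$, and let $\mathcal{F}_*(N)$ be the componentwise push-forward, $\mathcal{F}_*(\ell)=\ell\circ\mathcal{F}^{\mathrm{div}}$. Then, as functionals on $\mathrm{MTW}(\hat K)$, $$\mathcal{F}_*(N)=\begin{bmatrix} W^1&&\\&W^2&\\&&W^3\end{bmatrix}\hat N,\qquad W^k=\begin{bmatrix}1&0&0\\ \alpha^k&\beta^k&0\\0&0&1\end{bmatrix},\quad k=1,2,3.$$ Consequently, with $$P=\begin{bmatrix} (W^1)^{-1}&&\\&(W^2)^{-1}&\\&&(W^3)^{-1}\end{bmatrix},\qquad (W^k)^{-1}=\begin{bmatrix}1&0&0\\ -\alpha^k/\beta^k&1/\beta^k&0\\0&0&1\end{bmatrix},$$ one has $\hat N=P\,\mathcal{F}_*(N)$, and the nodal basis $\mathbf\Psi$ of $\mathrm{MTW}(K)$ (dual to $N$) is obtained from the nodal basis $\hat{\mathbf\Psi}$ of $\mathrm{MTW}(\hat K)$ (dual to $\hat N$) by $\mathbf\Psi=P^T\mathcal{F}^{\mathrm{div}}(\hat{\mathbf\Psi})$, with $\mathcal{F}^{\mathrm{div}}$ applied componentwise to the vector of basis functions.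
   Context: Geometry: the triangle $K$ has vertices $\mathbf x_1,\mathbf x_2,\mathbf x_3$; edge $\mathbf e_k$ is the edge not containing vertex $k$, regarded as the column vector running from its lower-numbered vertex to its higher-numbered vertex (and also as a set). Its unit tangent is $\mathbf t=\mathbf t_k=\mathbf e_k/\|\mathbf e_k\|$ and its unit normal is $\mathbf n=\mathbf n_k=R\mathbf t_k$ with $R=\begin{bmatrix}0&1\\-1&0\end{bmatrix}$. Hatted quantities are defined in the same way on $\hat K$. $F$ may reverse orientation, i.e. $\det J$ may be negative. Piola map: $\mathcal{F}^{\mathrm{div}}(\hat\Phi)=\frac{1}{\det J}J\,\hat\Phi\circ F^{-1}$ (no absolute value on $\det J$). Edge coefficients: for each $k$, $\begin{bmatrix}\alpha^k\\ \beta^k\end{bmatrix}=\frac{1}{\det J}\begin{bmatrix}\hat{\mathbf n}_k&\hat{\mathbf t}_k\end{bmatrix}^T J^TJ\,\hat{\mathbf t}_k$. Space: $\mathrm{MTW}(K)=\{\Phi\in\mathcal P_3(K;\mathbb{R}^2): \mathrm{div}\,\Phi\in\mathcal P_0(K),\ (\Phi\cdot\mathbf n)|_{\mathbf e_k}\in\mathcal P_1(\mathbf e_k),\ 1\le k\le 3\}$, of dimension 9, where $\mathcal P_m$ denotes polynomials of degree at most $m$. Degrees of freedom: let $\mu_0=1$ and $\mu_1$ be a basis of the polynomials of degree at most 1 on the unit interval, and $\mu_i^k$ the pullback of $\mu_i$ to $\mathbf e_k$ via the affine parametrization of $\mathbf e_k$ from its lower- to its higher-numbered vertex. Set $\ell^{\mathbf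 n,i,k}(\Phi)=\int_{\mathbf e_k}(\Phi\cdot\mathbf n)\,\mu_i^k\,ds$ and $\ell^{\mathbf t,0,k}(\Phi)=\int_{\mathbf e_k}\Phi\cdot\mathbf t\,ds$. The vector of degrees of freedom is the block column vector $N=[N^1,N^2,N^3]^T$ with $N^k=[\ell^{\mathbf n,0,k},\ \ell^{\mathbf t,0,k},\ \ell^{\mathbf n,1,k}]^T$; these functionals are unisolvent on $\mathrm{MTW}(K)$. $\hat N$ is defined identically on $\hat K$. The nodal basis $\mathbf\Psi=(\Psi_j)$ is the basis with $\ell_i(\Psi_j)=\delta_{ij}$ for the entries $\ell_i$ of $N$, and similarly for $\hat{\mathbf\Psi}$. *)

theory Defs
  imports "HOL-Analysis.Analysis" "HOL-Computational_Algebra.Polynomial"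
begin

text \<open>
  A triangle is given by its numbered vertices, a function on the three-element type \<open>3\<close>,
  whose elements are \<open>1\<close>, \<open>2\<close>, \<open>3\<close>.  The library order on this type has \<open>3 = 0 < 1 < 2\<close>,
  so the lower- and higher-numbered vertices of an edge are spelled out.
\<close>

type_synonym field2 = "real^2 \<Rightarrow> real^2"

definition triangle_of :: "(3 \<Rightarrow> real^2) \<Rightarrow> (real^2) set" where
  "triangle_of x = convex hull {x 1, x 2, x 3}"

definition nondegenerate :: "(3 \<Rightarrow> real^2) \<Rightarrow> bool" where
  "nondegenerate x \<longleftrightarrow> \<not> collinear {x 1, x 2, x 3}"

definition edge_lo :: "3 \<Rightarrow> 3" where
  "edge_lo k = (if k = 1 then 2 else 1)"

definition edge_hi :: "3 \<Rightarrow> 3" where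
  "edge_hi k = (if k = 3 then 2 else 3)"

definition edge_vec :: "(3 \<Rightarrow> real^2) \<Rightarrow> 3 \<Rightarrow> real^2" where
  "edge_vec x k = x (edge_hi k) - x (edge_lo k)"

definition edge_set :: "(3 \<Rightarrow> real^2) \<Rightarrow> 3 \<Rightarrow> (real^2) set" where
  "edge_set x k = closed_segment (x (edge_lo k)) (x (edge_hi k))"

definition edge_param :: "(3 \<Rightarrow> real^2) \<Rightarrow> 3 \<Rightarrow> real \<Rightarrow> real^2" where
  "edge_param x k s = x (edge_lo k) + s *\<^sub>R edge_vec x k"

definition tangent :: "(3 \<Rightarrow> real^2) \<Rightarrow> 3 \<Rightarrow> real^2" where
  "tangent x k = (1 / norm (edge_vec x k)) *\<^sub>R edge_vec x k"

definition rot :: "real^2^2" where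
  "rot = vector [vector [0, 1], vector [-1, 0]]"

definition normal_vec :: "(3 \<Rightarrow> real^2) \<Rightarrow> 3 \<Rightarrow> real^2" where
  "normal_vec x k = rot *v tangent x k"

text \<open>Restrictions to \<open>S\<close> of bivariate polynomials of total degree at most \<open>m\<close>.\<close>

definition poly_on :: "nat \<Rightarrow> (real^2) set \<Rightarrow> (real^2 \<Rightarrow> real) set" where
  "poly_on m S = {p. \<exists>c :: nat \<Rightarrow> nat \<Rightarrow> real. \<forall>z\<in>S.
      p z = (\<Sum>i\<le>m. \<Sum>j\<le>m - i. c i j * (z $ 1) ^ i * (z $ 2) ^ j)}"

definition divergence :: "field2 \<Rightarrow> real^2 \<Rightarrow> real" where
  "divergence \<Phi> z = trace (jacobian \<Phi> (at z))"

text \<open>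
  A vector field on \<open>K\<close> is a function that is \<open>undefined\<close> outside \<open>K\<close> (\<open>extensional\<close>), so
  equality of fields is equality on \<open>K\<close>.  The divergence is taken at interior points, where
  the full derivative depends on the values on \<open>K\<close> only; being polynomial, it is constant
  on \<open>K\<close> iff it is constant on the interior.
\<close>

definition MTW :: "(3 \<Rightarrow> real^2) \<Rightarrow> field2 set" where
  "MTW x = {\<Phi> \<in> extensional (triangle_of x).
      (\<forall>i. (\<lambda>z. \<Phi> z $ i) \<in> poly_on 3 (triangle_of x)) \<and>
      divergence \<Phi> \<in> poly_on 0 (interior (triangle_of x)) \<and>
      (\<forall>k. (\<lambda>z. \<Phi> z \<bullet> normal_vec x k) \<in> poly_on 1 (edge_set x k))}"

text \<open>Integral with respect to arc length over the \<open>k\<close>-th edge.\<close>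

definition edge_integral :: "(3 \<Rightarrow> real^2) \<Rightarrow> 3 \<Rightarrow> (real^2 \<Rightarrow> real) \<Rightarrow> real" where
  "edge_integral x k g =
     integral {0..1} (\<lambda>s. g (edge_param x k s) * norm (edge_vec x k))"

definition edge_pullback :: "(3 \<Rightarrow> real^2) \<Rightarrow> 3 \<Rightarrow> (real \<Rightarrow> real) \<Rightarrow> real^2 \<Rightarrow> real" where
  "edge_pullback x k f z = f (inv_into {0..1} (edge_param x k) z)"

definition P1_basis :: "(nat \<Rightarrow> real poly) \<Rightarrow> bool" where
  "P1_basis \<mu> \<longleftrightarrow> degree (\<mu> 0) \<le> 1 \<and> degree (\<mu> 1) \<le> 1 \<and>
     (\<forall>q. degree q \<le> 1 \<longrightarrow>
       (\<exists>!c :: real \<times> real. q = smult (fst c) (\<mu> 0) + smult (snd c) (\<mu> 1)))"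

definition normal_dof ::
    "(3 \<Rightarrow> real^2) \<Rightarrow> (nat \<Rightarrow> real poly) \<Rightarrow> nat \<Rightarrow> 3 \<Rightarrow> field2 \<Rightarrow> real" where
  "normal_dof x \<mu> i k \<Phi> =
     edge_integral x k (\<lambda>z. (\<Phi> z \<bullet> normal_vec x k) * edge_pullback x k (poly (\<mu> i)) z)"

definition tangent_dof :: "(3 \<Rightarrow> real^2) \<Rightarrow> 3 \<Rightarrow> field2 \<Rightarrow> real" where
  "tangent_dof x k \<Phi> = edge_integral x k (\<lambda>z. \<Phi> z \<bullet> tangent x k)"

text \<open>
  The nine degrees of freedom (and the nodal basis functions) are indexed by pairs: \<open>(k, i)\<close>
  is the \<open>i\<close>-th entry of the \<open>k\<close>-th block.
\<close>

definition dof ::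
    "(3 \<Rightarrow> real^2) \<Rightarrow> (nat \<Rightarrow> real poly) \<Rightarrow> 3 \<times> 3 \<Rightarrow> field2 \<Rightarrow> real" where
  "dof x \<mu> p \<Phi> = (case p of (k, i) \<Rightarrow>
     (vector [normal_dof x \<mu> 0 k \<Phi>, tangent_dof x k \<Phi>, normal_dof x \<mu> 1 k \<Phi>] :: real^3) $ i)"

text \<open>A matrix applied to a vector of fields on \<open>K\<close>, giving again a vector of fields on \<open>K\<close>.\<close>

definition mat_fields ::
    "(real^2) set \<Rightarrow> real^'n^'m \<Rightarrow> ('n::finite \<Rightarrow> field2) \<Rightarrow> ('m::finite \<Rightarrow> field2)" where
  "mat_fields K A \<Psi> = (\<lambda>i. restrict (\<lambda>z. \<Sum>j\<in>UNIV. (A $ i $ j) *\<^sub>R \<Psi> j z) K)"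

definition nodal_basis ::
    "(3 \<Rightarrow> real^2) \<Rightarrow> (nat \<Rightarrow> real poly) \<Rightarrow> (3 \<times> 3 \<Rightarrow> field2) \<Rightarrow> bool" where
  "nodal_basis x \<mu> \<Psi> \<longleftrightarrow>
     (\<forall>j. \<Psi> j \<in> MTW x) \<and>
     (\<forall>\<Phi>\<in>MTW x. \<exists>!c :: real^(3 \<times> 3).
        \<Phi> = restrict (\<lambda>z. \<Sum>j\<in>UNIV. (c $ j) *\<^sub>R \<Psi> j z) (triangle_of x)) \<and>
     (\<forall>i j. dof x \<mu> i (\<Psi> j) = (if i = j then 1 else 0))"

text \<open>Contravariant Piola map for \<open>F : Kh \<rightarrow> K\<close> with Jacobian matrix \<open>J\<close>.\<close>

definition piola ::
    "field2 \<Rightarrow> real^2^2 \<Rightarrow> (real^2) set \<Rightarrow> (real^2) set \<Rightarrow> field2 \<Rightarrow> field2" where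
  "piola F J Kh K \<Phi> =
     restrict (\<lambda>z. (1 / det J) *\<^sub>R (J *v \<Phi> (inv_into Kh F z))) K"

definition pushforward ::
    "field2 \<Rightarrow> real^2^2 \<Rightarrow> (real^2) set \<Rightarrow> (real^2) set \<Rightarrow> (field2 \<Rightarrow> real) \<Rightarrow> field2 \<Rightarrow> real" where
  "pushforward F J Kh K L = L \<circ> piola F J Kh K"

text \<open>
  The vector with entries \<open>\<alpha>\<^sup>k\<close>, \<open>\<beta>\<^sup>k\<close>, for the vertices \<open>xh\<close> of the reference triangle.
  Since \<open>vector\<close> lists rows, the first factor is the transpose of the matrix with columns
  \<open>n\<close> and \<open>t\<close>.
\<close>

definition edge_coeffs :: "(3 \<Rightarrow> real^2) \<Rightarrow> real^2^2 \<Rightarrow> 3 \<Rightarrow> real^2" where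
  "edge_coeffs xh J k = (1 / det J) *\<^sub>R
     (((vector [normal_vec xh k, tangent xh k] :: real^2^2) ** transpose J ** J) *v tangent xh k)"

definition alpha :: "(3 \<Rightarrow> real^2) \<Rightarrow> real^2^2 \<Rightarrow> 3 \<Rightarrow> real" where
  "alpha xh J k = edge_coeffs xh J k $ 1"

definition beta :: "(3 \<Rightarrow> real^2) \<Rightarrow> real^2^2 \<Rightarrow> 3 \<Rightarrow> real" where
  "beta xh J k = edge_coeffs xh J k $ 2"

definition W_block :: "(3 \<Rightarrow> real^2) \<Rightarrow> real^2^2 \<Rightarrow> 3 \<Rightarrow> real^3^3" where
  "W_block xh J k = vector
     [vector [1, 0, 0],
      vector [alpha xh J k, beta xh J k, 0],
      vector [0, 0, 1]]"

definition block_diag :: "('k \<Rightarrow> real^'m^'m) \<Rightarrow> real^('k::finite \<times> 'm::finite)^('k \<times> 'm)" where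
  "block_diag B = (\<chi> p q. if fst p = fst q then B (fst p) $ snd p $ snd q else 0)"

definition P_mat :: "(3 \<Rightarrow> real^2) \<Rightarrow> real^2^2 \<Rightarrow> real^(3 \<times> 3)^(3 \<times> 3)" where
  "P_mat xh J = block_diag (\<lambda>k. matrix_inv (W_block xh J k))"

end

theory Submission
  imports Defs
begin

text \<open>
  Write \<open>e'\<close> and \<open>e = J e'\<close> for corresponding edge vectors.  After parametrising the edge
  over the unit interval, each degree of freedom is an integral of \<open>(\<Phi> \<bullet> v) q\<close> with a polynomial
  weight \<open>q\<close>, where \<open>v = R e\<close> for the normal ones and \<open>v = e\<close> for the tangential one: the length of
  the edge cancels the normalisation of \<open>n\<close> and \<open>t\<close>.  The weight does not see the triangle, so the Piola
  map acts on such an integral only by replacing the direction \<open>v\<close> by \<open>J\<^sup>T v / det J\<close>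
  (\<open>edge_moment_Piola\<close>).

  Everything follows from what this does to the two directions.  Since \<open>J\<^sup>T R J = det J \<cdot> R\<close> for
  every two-by-two matrix, \<open>R e\<close> becomes \<open>R e'\<close>, and the normal degrees of freedom are preserved,
  including their sign.  The direction \<open>e\<close> becomes \<open>J\<^sup>T J e' / det J\<close>, whose
  coordinates in the orthogonal basis \<open>R e'\<close>, \<open>e'\<close> are exactly \<open>\<alpha>\<close> and \<open>\<beta>\<close>
  (\<open>tangent_direction\<close>); because \<open>\<mu>\<^sub>0 = 1\<close>, the \<open>R e'\<close> part is again a degree of freedom.  This
  gives the blocks \<open>W\<close>.  They are invertible because \<open>\<beta> = \<bar>e\<bar>\<^sup>2 / (det J \<bar>e'\<bar>\<^sup>2)\<close>.

  The Piola map sends the reference space into the space on \<open>K\<close> (\<open>Piola_MTW\<close>):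
  an affine substitution preserves the polynomial degree, the divergence is scaled by
  \<open>1 / det J\<close> since the trace is invariant under conjugation, and the normal component on an edge
  is preserved up to a constant factor.  The inverse affine map satisfies the same
  hypotheses, so the Piola map is onto.  Hence a field \<open>\<Phi>\<close> on \<open>K\<close> is the image of a reference field, which
  is expanded in the reference nodal basis with coefficients \<open>P N(\<Phi>)\<close>; collecting the
  coefficients of \<open>N(\<Phi>)\<close> turns this into an expansion in the fields \<open>P\<^sup>T\<close> applied to the images, which are
  dual to \<open>N\<close> because \<open>W P = 1\<close>.  As a nodal basis is unique, there is no other.
\<close>

section \<open>Bivariate polynomials of bounded degree\<close>

lemma poly_on_cong:
  assumes "\<And>z. z \<in> S \<Longrightarrow> p z = q z"
  shows "p \<in> poly_on m S \<longleftrightarrow> q \<in> poly_on m S"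
  using assms by (auto simp: poly_on_def)

lemma poly_on_zero: "(\<lambda>z. 0) \<in> poly_on m S"
  unfolding poly_on_def by (auto intro!: exI[of _ "\<lambda>_ _. 0"])

lemma poly_on_add:
  assumes "p \<in> poly_on m S" and "q \<in> poly_on m S"
  shows "(\<lambda>z. p z + q z) \<in> poly_on m S"
proof -
  obtain c d :: "nat \<Rightarrow> nat \<Rightarrow> real"
    where "\<forall>z\<in>S. p z = (\<Sum>i\<le>m. \<Sum>j\<le>m - i. c i j * (z $ 1) ^ i * (z $ 2) ^ j)"
      and "\<forall>z\<in>S. q z = (\<Sum>i\<le>m. \<Sum>j\<le>m - i. d i j * (z $ 1) ^ i * (z $ 2) ^ j)"
    using assms by (auto simp: poly_on_def)
  then have "\<forall>z\<in>S. p z + q z =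
      (\<Sum>i\<le>m. \<Sum>j\<le>m - i. (c i j + d i j) * (z $ 1) ^ i * (z $ 2) ^ j)"
    by (simp add: distrib_right sum.distrib)
  then show ?thesis
    by (auto simp: poly_on_def intro!: exI[of _ "\<lambda>i j. c i j + d i j"])
qed

lemma poly_on_scale:
  assumes "p \<in> poly_on m S"
  shows "(\<lambda>z. a * p z) \<in> poly_on m S"
proof -
  obtain c :: "nat \<Rightarrow> nat \<Rightarrow> real"
    where "\<forall>z\<in>S. p z = (\<Sum>i\<le>m. \<Sum>j\<le>m - i. c i j * (z $ 1) ^ i * (z $ 2) ^ j)"
    using assms by (auto simp: poly_on_def)
  then have "\<forall>z\<in>S. a * p z =
      (\<Sum>i\<le>m. \<Sum>j\<le>m - i. (a * c i j) * (z $ 1) ^ i * (z $ 2) ^ j)"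
    by (simp add: sum_distrib_left mult.assoc)
  then show ?thesis
    by (auto simp: poly_on_def intro!: exI[of _ "\<lambda>i j. a * c i j"])
qed

lemma poly_on_sum:
  assumes "\<And>i. i \<in> I \<Longrightarrow> p i \<in> poly_on m S"
  shows "(\<lambda>z. \<Sum>i\<in>I. p i z) \<in> poly_on m S"
  using assms
  by (induction I rule: infinite_finite_induct) (auto intro: poly_on_zero poly_on_add)

lemma poly_on_monomial:
  assumes "i + j \<le> m"
  shows "(\<lambda>z. (z $ 1) ^ i * (z $ 2) ^ j) \<in> poly_on m S"
proof -
  define c :: "nat \<Rightarrow> nat \<Rightarrow> real" where "c = (\<lambda>i' j'. if i' = i then if j' = j then 1 else 0 else 0)"
  have "(\<Sum>i'\<le>m. \<Sum>j'\<le>m - i'. c i' j' * (z $ 1) ^ i' * (z $ 2) ^ j') =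
      (z $ 1) ^ i * (z $ 2) ^ j" for z :: "real^2"
  proof -
    have "(\<Sum>j'\<le>m - i'. c i' j' * (z $ 1) ^ i' * (z $ 2) ^ j') =
        (if i' = i then (z $ 1) ^ i * (z $ 2) ^ j else 0)" for i'
      using assms by (auto simp: c_def if_distrib[of "\<lambda>t. t * _"] cong: if_cong)
    then show ?thesis
      using assms by simp
  qed
  then show ?thesis
    by (auto simp: poly_on_def intro!: exI[of _ c])
qed

lemma poly_on_coeffs:
  assumes "p \<in> poly_on m S"
  shows "\<exists>c :: nat \<Rightarrow> nat \<Rightarrow> real. \<forall>z. z \<in> S \<longrightarrow>
    p z = (\<Sum>i\<le>m. \<Sum>j\<le>m - i. c i j * ((z $ 1) ^ i * (z $ 2) ^ j))"
  using assms by (auto simp: poly_on_def mult.assoc)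

lemma poly_on_mono:
  assumes "p \<in> poly_on m S" and "m \<le> n"
  shows "p \<in> poly_on n S"
proof -
  obtain c where c: "\<And>z. z \<in> S \<Longrightarrow> p z = (\<Sum>i\<le>m. \<Sum>j\<le>m - i. c i j * ((z $ 1) ^ i * (z $ 2) ^ j))"
    using poly_on_coeffs[OF assms(1)] by blast
  have "(\<lambda>z. \<Sum>i\<le>m. \<Sum>j\<le>m - i. c i j * ((z $ 1) ^ i * (z $ 2) ^ j)) \<in> poly_on n S"
    using assms(2) by (intro poly_on_sum poly_on_scale poly_on_monomial) auto
  then show ?thesis
    by (subst poly_on_cong[OF c]) (auto)
qed

lemma poly_on_mult:
  assumes "p \<in> poly_on m S" and "q \<in> poly_on n S"
  shows "(\<lambda>z. p z * q z) \<in> poly_on (m + n) S"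
proof -
  obtain c where c: "\<And>z. z \<in> S \<Longrightarrow> p z = (\<Sum>i\<le>m. \<Sum>j\<le>m - i. c i j * ((z $ 1) ^ i * (z $ 2) ^ j))"
    using poly_on_coeffs[OF assms(1)] by blast
  obtain d where d: "\<And>z. z \<in> S \<Longrightarrow> q z = (\<Sum>i\<le>n. \<Sum>j\<le>n - i. d i j * ((z $ 1) ^ i * (z $ 2) ^ j))"
    using poly_on_coeffs[OF assms(2)] by blast
  have pq: "p z * q z = (\<Sum>i\<le>m. \<Sum>j\<le>m - i. \<Sum>k\<le>n. \<Sum>l\<le>n - k.
      (c i j * d k l) * ((z $ 1) ^ (i + k) * (z $ 2) ^ (j + l)))" if "z \<in> S" for z
    unfolding c[OF that] d[OF that]
    by (simp only: sum_distrib_right, simp only: sum_distrib_left)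
      (simp only: power_add mult_ac)
  have "(\<lambda>z. \<Sum>i\<le>m. \<Sum>j\<le>m - i. \<Sum>k\<le>n. \<Sum>l\<le>n - k.
      (c i j * d k l) * ((z $ 1) ^ (i + k) * (z $ 2) ^ (j + l))) \<in> poly_on (m + n) S"
    by (intro poly_on_sum poly_on_scale poly_on_monomial) auto
  then show ?thesis
    using poly_on_cong[of S "\<lambda>z. p z * q z", OF pq] by blast
qed

lemma poly_on_const: "(\<lambda>z. a) \<in> poly_on m S"
  using poly_on_scale[OF poly_on_monomial[of 0 0 m S], of a] by simp

lemma poly_on_power:
  assumes "p \<in> poly_on 1 S"
  shows "(\<lambda>z. p z ^ i) \<in> poly_on i S"
proof (induction i)
  case 0
  then show ?case by (simp add: poly_on_const)
next
  case (Suc i)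
  then show ?case
    using poly_on_mult[OF assms Suc] by simp
qed

text \<open>
  Degrees add under multiplication, so inserting functions of degree one into a monomial does not
  raise its degree.
\<close>

lemma poly_on_compose:
  assumes p: "p \<in> poly_on m T" and g: "\<And>i. (\<lambda>z. g z $ i) \<in> poly_on 1 S" and "g ` S \<subseteq> T"
  shows "(\<lambda>z. p (g z)) \<in> poly_on m S"
proof -
  obtain c where c: "\<And>z. z \<in> T \<Longrightarrow> p z = (\<Sum>i\<le>m. \<Sum>j\<le>m - i. c i j * ((z $ 1) ^ i * (z $ 2) ^ j))"
    using poly_on_coeffs[OF p] by blast
  have "(\<lambda>z. \<Sum>i\<le>m. \<Sum>j\<le>m - i. c i j * ((g z $ 1) ^ i * (g z $ 2) ^ j)) \<in> poly_on m S"
  proof (intro poly_on_sum poly_on_scale)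
    fix i j assume "i \<in> {..m}" "j \<in> {..m - i}"
    then have "i + j \<le> m" by auto
    then show "(\<lambda>z. (g z $ 1) ^ i * (g z $ 2) ^ j) \<in> poly_on m S"
      using poly_on_mono[OF poly_on_mult[OF poly_on_power[OF g] poly_on_power[OF g]]] by blast
  qed
  moreover have pg: "p (g z) = (\<Sum>i\<le>m. \<Sum>j\<le>m - i. c i j * ((g z $ 1) ^ i * (g z $ 2) ^ j))"
    if "z \<in> S" for z
    using c[of "g z"] that assms(3) by auto
  ultimately show ?thesis
    using poly_on_cong[of S "\<lambda>z. p (g z)", OF pg] by blast
qed

lemma poly_on_affine:
  fixes A :: "real^2^2"
  shows "(\<lambda>z. (A *v (z - b)) $ i) \<in> poly_on 1 S"
proof -
  have eq: "(A *v (z - b)) $ i =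
      (A $ i $ 1 * z $ 1 + A $ i $ 2 * z $ 2) + - ((A *v b) $ i)" for z
    by (simp add: matrix_vector_mult_def sum_2 algebra_simps)
  have "(\<lambda>z. z $ 1) \<in> poly_on 1 S" "(\<lambda>z. z $ 2) \<in> poly_on 1 S"
    using poly_on_monomial[of 1 0 1 S] poly_on_monomial[of 0 1 1 S] by simp_all
  then show ?thesis
    unfolding eq by (intro poly_on_add poly_on_scale poly_on_const)
qed

lemma poly_on_continuous:
  assumes "p \<in> poly_on m S"
  shows "continuous_on S p"
proof -
  obtain c where c: "\<And>z. z \<in> S \<Longrightarrow> p z = (\<Sum>i\<le>m. \<Sum>j\<le>m - i. c i j * ((z $ 1) ^ i * (z $ 2) ^ j))"
    using poly_on_coeffs[OF assms] by blast
  have "continuous_on S (\<lambda>z. \<Sum>i\<le>m. \<Sum>j\<le>m - i. c i j * ((z $ 1) ^ i * (z $ 2) ^ j))"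
    by (intro continuous_intros)
  then show ?thesis
    using c by (simp cong: continuous_on_cong)
qed

lemma poly_on_differentiable:
  assumes "p \<in> poly_on m S" and "z \<in> interior S"
  shows "p differentiable (at z)"
proof -
  obtain c where c: "\<And>z. z \<in> S \<Longrightarrow> p z = (\<Sum>i\<le>m. \<Sum>j\<le>m - i. c i j * ((z $ 1) ^ i * (z $ 2) ^ j))"
    using poly_on_coeffs[OF assms(1)] by blast
  have coord: "(\<lambda>w. w $ i) differentiable (at z)" for i
    by (simp add: bounded_linear_imp_differentiable bounded_linear_vec_nth)
  have mono: "(\<lambda>w. a * ((w $ 1) ^ i * (w $ 2) ^ j)) differentiable (at z)" for a i j
    by (rule differentiable_mult[OF differentiable_const differentiable_mult[OF
          differentiable_power[OF coord] differentiable_power[OF coord]]])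
  have "(\<lambda>w. \<Sum>i\<le>m. \<Sum>j\<le>m - i. c i j * ((w $ 1) ^ i * (w $ 2) ^ j)) differentiable (at z)"
    using mono by (simp add: differentiable_sum)
  then obtain D where
    D: "((\<lambda>w. \<Sum>i\<le>m. \<Sum>j\<le>m - i. c i j * ((w $ 1) ^ i * (w $ 2) ^ j)) has_derivative D) (at z)"
    unfolding differentiable_def by blast
  have eq: "(\<Sum>i\<le>m. \<Sum>j\<le>m - i. c i j * ((w $ 1) ^ i * (w $ 2) ^ j)) = p w"
    if "w \<in> interior S" for w
    using c that interior_subset[of S] by (simp add: subset_iff)
  have "(p has_derivative D) (at z)"
    by (rule has_derivative_transform_within_open[OF D open_interior assms(2) eq])
  then show ?thesis
    unfolding differentiable_def by blast
qed

section \<open>Linear algebra in the plane\<close>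

lemma sum_matrix_vector_mult:
  fixes A :: "'j \<Rightarrow> real^'n^'m"
  shows "(\<Sum>j\<in>I. c j *\<^sub>R A j) *v h = (\<Sum>j\<in>I. c j *\<^sub>R (A j *v h))"
  by (induction I rule: infinite_finite_induct)
    (simp_all add: matrix_vector_mult_add_rdistrib scaleR_matrix_vector_assoc)

lemma trace_sum_scale:
  fixes A :: "'j \<Rightarrow> real^'n^'n"
  shows "trace (\<Sum>j\<in>I. c j *\<^sub>R A j) = (\<Sum>j\<in>I. c j * trace (A j))"
  unfolding trace_def by (simp add: sum_distrib_left) (rule sum.swap)

lemma rot_decomposition:
  "(w \<bullet> w) *\<^sub>R v = (v \<bullet> w) *\<^sub>R w + (v \<bullet> (rot *v w)) *\<^sub>R (rot *v w)"
  by (simp add: vec_eq_iff forall_2 rot_def matrix_vector_mult_def sum_2 inner_vec_def algebra_simps)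

text \<open>
  If \<open>J w = 0\<close>, only the component of \<open>v\<close> along the rotated vector \<open>R w\<close> contributes to \<open>J v\<close>.
  This shows that a map onto a nondegenerate triangle has an invertible Jacobian.
\<close>

lemma singular_range_line:
  fixes J :: "real^2^2"
  assumes "det J = 0"
  shows "\<exists>u. \<forall>v. \<exists>c. J *v v = c *\<^sub>R u"
proof -
  obtain w where w: "w \<noteq> 0" "J *v w = 0"
    using assms invertible_det_nz[of J] matrix_left_invertible_ker[of J] invertible_left_inverse[of J]
    by blast
  have "J *v v = ((v \<bullet> (rot *v w)) / (w \<bullet> w)) *\<^sub>R (J *v (rot *v w))" for v
  proof -
    have "(w \<bullet> w) *\<^sub>R (J *v v) = (v \<bullet> (rot *v w)) *\<^sub>R (J *v (rot *v w))"
      using arg_cong[OF rot_decomposition[of w v], of "(*v) J"] w(2)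
      by (simp add: matrix_vector_right_distrib matrix_vector_mult_scaleR)
    then have "(1 / (w \<bullet> w)) *\<^sub>R ((w \<bullet> w) *\<^sub>R (J *v v)) =
        (1 / (w \<bullet> w)) *\<^sub>R ((v \<bullet> (rot *v w)) *\<^sub>R (J *v (rot *v w)))"
      by (rule arg_cong)
    then show ?thesis
      using w(1) by simp
  qed
  then show ?thesis by blast
qed

text \<open>
  The identity \<open>J\<^sup>T R J = det J \<cdot> R\<close>, in the form of inner products: \<open>v \<bullet> R w\<close> is a
  two-by-two determinant, and determinants are multiplicative.
\<close>

lemma rot_piola:
  fixes J :: "real^2^2"
  shows "(J *v v) \<bullet> (rot *v (J *v w)) = det J * (v \<bullet> (rot *v w))"
  by (simp add: rot_def matrix_vector_mult_def sum_2 inner_vec_def det_2 algebra_simps)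

lemma matrix_inv_eqI:
  fixes A B :: "'a::semiring_1^'n^'n"
  assumes "A ** B = mat 1" and "B ** A = mat 1"
  shows "matrix_inv A = B"
proof -
  have "A ** matrix_inv A = mat 1 \<and> matrix_inv A ** A = mat 1"
    unfolding matrix_inv_def by (rule someI[of _ B]) (use assms in simp)
  then show ?thesis
    by (metis assms(2) matrix_mul_assoc matrix_mul_lid matrix_mul_rid)
qed

section \<open>The Mardal--Tai--Winther space\<close>

lemma divergence_eqI:
  assumes "(\<Phi> has_derivative (\<lambda>h. A *v h)) (at z)"
  shows "divergence \<Phi> z = trace A"
  using frechet_derivative_at[OF assms] matrix_of_matrix_vector_mul[of A]
  by (simp add: divergence_def jacobian_def)

text \<open>
  The derivative in the definition of the divergence is meaningful only where the field is
  differentiable; a polynomial on the triangle is differentiable at its interior points.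
\<close>

lemma MTW_has_derivative:
  assumes "\<Phi> \<in> MTW x" and "z \<in> interior (triangle_of x)"
  shows "(\<Phi> has_derivative (\<lambda>h. jacobian \<Phi> (at z) *v h)) (at z)"
proof -
  have comp: "(\<lambda>z. \<Phi> z $ i) differentiable (at z)" for i
  proof -
    have "(\<lambda>z. \<Phi> z $ i) \<in> poly_on 3 (triangle_of x)"
      using assms(1) by (simp add: MTW_def)
    then show ?thesis
      using assms(2) by (rule poly_on_differentiable)
  qed
  have "(\<lambda>z. \<Phi> z \<bullet> u) differentiable (at z)" if u: "u \<in> Basis" for u
  proof -
    obtain i where "u = axis i 1"
      using u by (auto simp: Basis_vec_def)
    then show ?thesis
      using comp[of i] by (simp add: inner_axis)
  qed
  then have "\<Phi> differentiable (at z)"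
    by (subst differentiable_componentwise_within) blast
  then show ?thesis
    by (simp add: jacobian_works)
qed

lemma MTW_divergence_const:
  assumes "\<Phi> \<in> MTW x"
  obtains a where "\<And>z. z \<in> interior (triangle_of x) \<Longrightarrow> divergence \<Phi> z = a"
proof -
  have "divergence \<Phi> \<in> poly_on 0 (interior (triangle_of x))"
    using assms by (simp add: MTW_def)
  then show ?thesis
    using that by (auto simp: poly_on_def)
qed

lemma edge_subset_triangle: "edge_set x k \<subseteq> triangle_of x"
  unfolding edge_set_def triangle_of_def segment_convex_hull
  by (rule hull_mono) (auto simp: edge_lo_def edge_hi_def)

lemma edge_set_param: "edge_set x k = edge_param x k ` {0..1}"
proof -
  have "(1 - u) *\<^sub>R x (edge_lo k) + u *\<^sub>R x (edge_hi k) = edge_param x k u" for u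
    by (simp add: edge_param_def edge_vec_def algebra_simps)
  then show ?thesis
    by (auto simp: edge_set_def closed_segment_def)
qed

lemma MTW_linear_combination:
  fixes \<Psi> :: "'j \<Rightarrow> field2"
  assumes \<Psi>: "\<And>j. j \<in> I \<Longrightarrow> \<Psi> j \<in> MTW x"
  shows "restrict (\<lambda>z. \<Sum>j\<in>I. c j *\<^sub>R \<Psi> j z) (triangle_of x) \<in> MTW x"
proof -
  let ?K = "triangle_of x"
  let ?\<Phi> = "restrict (\<lambda>z. \<Sum>j\<in>I. c j *\<^sub>R \<Psi> j z) ?K"
  have poly: "(\<lambda>z. ?\<Phi> z $ i) \<in> poly_on 3 ?K" for i
  proof -
    have eq: "?\<Phi> z $ i = (\<Sum>j\<in>I. c j * \<Psi> j z $ i)" if "z \<in> ?K" for z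
      using that by simp
    have "(\<lambda>z. \<Sum>j\<in>I. c j * \<Psi> j z $ i) \<in> poly_on 3 ?K"
      by (intro poly_on_sum poly_on_scale) (use \<Psi> in \<open>auto simp: MTW_def\<close>)
    then show ?thesis
      by (subst poly_on_cong[OF eq]) auto
  qed
  have normal: "(\<lambda>z. ?\<Phi> z \<bullet> normal_vec x k) \<in> poly_on 1 (edge_set x k)" for k
  proof -
    have eq: "?\<Phi> z \<bullet> normal_vec x k = (\<Sum>j\<in>I. c j * (\<Psi> j z \<bullet> normal_vec x k))"
      if "z \<in> edge_set x k" for z
      using that edge_subset_triangle[of x k] by (auto simp: inner_sum_left)
    have "(\<lambda>z. \<Sum>j\<in>I. c j * (\<Psi> j z \<bullet> normal_vec x k)) \<in> poly_on 1 (edge_set x k)"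
      by (intro poly_on_sum poly_on_scale) (use \<Psi> in \<open>auto simp: MTW_def\<close>)
    then show ?thesis
      by (subst poly_on_cong[OF eq]) auto
  qed
  have div_eq: "divergence ?\<Phi> z = (\<Sum>j\<in>I. c j * divergence (\<Psi> j) z)" if z: "z \<in> interior ?K" for z
  proof -
    have "((\<lambda>z. \<Sum>j\<in>I. c j *\<^sub>R \<Psi> j z) has_derivative
        (\<lambda>h. \<Sum>j\<in>I. c j *\<^sub>R (jacobian (\<Psi> j) (at z) *v h))) (at z)"
      by (intro has_derivative_sum has_derivative_scaleR_right MTW_has_derivative[OF \<Psi> z])
    then have "((\<lambda>z. \<Sum>j\<in>I. c j *\<^sub>R \<Psi> j z) has_derivative
        (\<lambda>h. (\<Sum>j\<in>I. c j *\<^sub>R jacobian (\<Psi> j) (at z)) *v h)) (at z)"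
      by (simp add: sum_matrix_vector_mult)
    then have "(?\<Phi> has_derivative (\<lambda>h. (\<Sum>j\<in>I. c j *\<^sub>R jacobian (\<Psi> j) (at z)) *v h)) (at z)"
      by (rule has_derivative_transform_within_open[OF _ open_interior z])
        (use interior_subset[of ?K] in auto)
    then have "divergence ?\<Phi> z = (\<Sum>j\<in>I. c j * trace (jacobian (\<Psi> j) (at z)))"
      by (subst divergence_eqI) (auto simp: trace_sum_scale)
    then show ?thesis
      by (simp add: divergence_def)
  qed
  have "(\<lambda>z. \<Sum>j\<in>I. c j * divergence (\<Psi> j) z) \<in> poly_on 0 (interior ?K)"
    by (intro poly_on_sum poly_on_scale) (use \<Psi> in \<open>auto simp: MTW_def\<close>)
  then have "divergence ?\<Phi> \<in> poly_on 0 (interior ?K)"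
    by (subst poly_on_cong[OF div_eq]) auto
  with poly normal show ?thesis
    by (simp add: MTW_def)
qed

lemma edge_vec_nonzero:
  assumes "nondegenerate x"
  shows "edge_vec x k \<noteq> 0"
proof
  assume "edge_vec x k = 0"
  then have "x 2 = x 3 \<or> x 1 = x 3 \<or> x 1 = x 2"
    by (auto simp: edge_vec_def edge_lo_def edge_hi_def split: if_splits)
  then have "collinear {x 1, x 2, x 3}"
    by (auto simp: insert_commute)
  with assms show False
    by (simp add: nondegenerate_def)
qed

section \<open>The Piola map between two triangles\<close>

text \<open>
  The inverse map satisfies the same assumptions, with the triangles exchanged.  Interpreting the locale a
  second time with it turns statements about the Piola map into its surjectivity.
\<close>

locale affine_triangle_map =
  fixes F :: "real^2 \<Rightarrow> real^2" and J :: "real^2^2" and b :: "real^2"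
    and xh x :: "3 \<Rightarrow> real^2"
  assumes ndh: "nondegenerate xh" and nd: "nondegenerate x"
    and bij: "bij_betw F (triangle_of xh) (triangle_of x)"
    and F_affine: "\<And>z. z \<in> triangle_of xh \<Longrightarrow> F z = J *v z + b"
    and F_vertex: "F (xh i) = x i"
begin

abbreviation "Kh \<equiv> triangle_of xh"
abbreviation "K \<equiv> triangle_of x"
abbreviation "Piola \<equiv> piola F J Kh K"
abbreviation "Ji \<equiv> matrix_inv J"

lemma vertex_in: "xh i \<in> Kh"
  using exhaust_3[of i] unfolding triangle_of_def by (auto intro: hull_inc)

lemma vertex_diff: "J *v (xh i - xh j) = x i - x j"
  using F_affine[OF vertex_in[of i]] F_affine[OF vertex_in[of j]] F_vertex[of i] F_vertex[of j]
  by (simp add: matrix_vector_mult_diff_distrib)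

lemma edge_vec_map: "J *v edge_vec xh k = edge_vec x k"
  by (simp add: edge_vec_def vertex_diff)

text \<open>
  A singular Jacobian would send the reference triangle to a line.
\<close>

lemma det_nonzero: "det J \<noteq> 0"
proof
  assume "det J = 0"
  then obtain u where "\<forall>v. \<exists>c. J *v v = c *\<^sub>R u"
    using singular_range_line by blast
  then have "\<exists>c. x i - x j = c *\<^sub>R u" for i j
    using vertex_diff[of i j] by metis
  then have "collinear {x 1, x 2, x 3}"
    unfolding collinear_def by blast
  with nd show False
    by (simp add: nondegenerate_def)
qed

lemma J_inv: "J ** Ji = mat 1" "Ji ** J = mat 1"
proof -
  obtain A where "J ** A = mat 1" "A ** J = mat 1"
    using det_nonzero invertible_det_nz[of J] by (auto simp: invertible_def)
  then show "J ** Ji = mat 1" "Ji ** J = mat 1"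
    using matrix_inv_eqI by blast+
qed

lemma J_inv_vec: "J *v (Ji *v v) = v" "Ji *v (J *v v) = v"
  by (simp_all add: matrix_vector_mul_assoc J_inv)

lemma det_J_inv: "det Ji = 1 / det J"
  using arg_cong[OF J_inv(1), of det] det_nonzero by (simp add: det_mul field_simps)

lemma F_inverse:
  assumes "z \<in> K"
  shows "inv_into Kh F z = Ji *v (z - b)" and "Ji *v (z - b) \<in> Kh"
proof -
  have "z \<in> F ` Kh"
    using assms bij_betw_imp_surj_on[OF bij] by simp
  then obtain w where w: "w \<in> Kh" "F w = z"
    by auto
  then have "Ji *v (z - b) = w"
    using F_affine[OF w(1)] by (auto simp: J_inv_vec)
  moreover have "inv_into Kh F z = w"
    using w bij by (auto simp: bij_betw_def)
  ultimately show "inv_into Kh F z = Ji *v (z - b)" and "Ji *v (z - b) \<in> Kh"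
    using w by auto
qed

lemma reverse: "affine_triangle_map (inv_into Kh F) Ji (- (Ji *v b)) x xh"
proof
  show "bij_betw (inv_into Kh F) K Kh"
    by (rule bij_betw_inv_into[OF bij])
  show "inv_into Kh F z = Ji *v z + - (Ji *v b)" if "z \<in> K" for z
    using F_inverse(1)[OF that] by (simp add: matrix_vector_mult_diff_distrib)
  show "inv_into Kh F (x i) = xh i" for i
    using F_vertex[of i] vertex_in[of i] bij by (metis bij_betw_inv_into_left)
qed (fact nd ndh)+

lemma Piola_apply:
  assumes "z \<in> K"
  shows "Piola \<Phi> z = (1 / det J) *\<^sub>R (J *v \<Phi> (Ji *v (z - b)))"
  using assms by (simp add: piola_def F_inverse(1))

lemma Piola_at_image:
  assumes "w \<in> Kh"
  shows "Piola \<Phi> (F w) = (1 / det J) *\<^sub>R (J *v \<Phi> w)"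
proof -
  have "F w \<in> K"
    using bij assms by (auto simp: bij_betw_def)
  then show ?thesis
    by (simp add: Piola_apply F_affine[OF assms] J_inv_vec)
qed

lemma Piola_sum:
  "Piola (restrict (\<lambda>w. \<Sum>j\<in>I. c j *\<^sub>R \<Phi> j w) Kh) =
   restrict (\<lambda>z. \<Sum>j\<in>I. c j *\<^sub>R Piola (\<Phi> j) z) K"
proof
  fix z
  have lin: "J *v (\<Sum>j\<in>I. c j *\<^sub>R v j) = (\<Sum>j\<in>I. c j *\<^sub>R (J *v v j))" for v
    by (simp add: linear_sum[OF matrix_vector_mul_linear] matrix_vector_mult_scaleR o_def)
  show "Piola (restrict (\<lambda>w. \<Sum>j\<in>I. c j *\<^sub>R \<Phi> j w) Kh) z =
      restrict (\<lambda>z. \<Sum>j\<in>I. c j *\<^sub>R Piola (\<Phi> j) z) K z"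
  proof (cases "z \<in> K")
    case True
    then show ?thesis
      by (simp add: Piola_apply F_inverse(2) lin scaleR_sum_right mult.commute)
  next
    case False
    then show ?thesis by (simp add: piola_def)
  qed
qed

lemma Piola_reverse:
  assumes "\<Phi> \<in> extensional K"
  shows "Piola (piola (inv_into Kh F) Ji K Kh \<Phi>) = \<Phi>"
proof
  fix z
  interpret R: affine_triangle_map "inv_into Kh F" Ji "- (Ji *v b)" x xh
    by (rule reverse)
  show "Piola (piola (inv_into Kh F) Ji K Kh \<Phi>) z = \<Phi> z"
  proof (cases "z \<in> K")
    case True
    then have "Piola (piola (inv_into Kh F) Ji K Kh \<Phi>) z =
        (1 / det J) *\<^sub>R (J *v R.Piola \<Phi> (inv_into Kh F z))"
      by (simp add: Piola_apply F_inverse(1))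
    also have "\<dots> = \<Phi> z"
      using det_nonzero
      by (simp add: R.Piola_at_image[OF True] det_J_inv J_inv_vec matrix_vector_mult_scaleR)
    finally show ?thesis .
  next
    case False
    then show ?thesis
      using assms by (simp add: piola_def extensional_def)
  qed
qed

text \<open>
  The preimage of the interior of \<open>K\<close> under the globally affine extension of \<open>F\<close> is open and
  contained in the reference triangle.
\<close>

lemma interior_preimage:
  assumes "z \<in> interior K"
  shows "Ji *v (z - b) \<in> interior Kh"
proof -
  define U where "U = (\<lambda>w. J *v w + b) -` interior K"
  have "open U"
    unfolding U_def
    by (intro open_vimage open_interior continuous_intros matrix_vector_mult_linear_continuous_on)
  moreover have "U \<subseteq> Kh"
  proof
    fix w assume "w \<in> U"
    then have "J *v w + b \<in> K"
      using interior_subset by (auto simp: U_def)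
    from F_inverse(2)[OF this] show "w \<in> Kh"
      by (simp add: J_inv_vec)
  qed
  moreover have "Ji *v (z - b) \<in> U"
    using assms by (simp add: U_def J_inv_vec)
  ultimately show ?thesis
    by (auto simp: interior_def)
qed

text \<open>
  The Jacobian of the image field is \<open>J D J' / det J\<close> with \<open>J'\<close> the inverse of \<open>J\<close>, a conjugate of \<open>D\<close> up to the factor.
\<close>

lemma Piola_divergence:
  assumes "\<Phi> \<in> MTW xh" and z: "z \<in> interior K"
  shows "divergence (Piola \<Phi>) z = (1 / det J) * divergence \<Phi> (Ji *v (z - b))"
proof -
  define w where "w = Ji *v (z - b)"
  define D where "D = jacobian \<Phi> (at w)"
  have D: "(\<Phi> has_derivative (\<lambda>h. D *v h)) (at w)"
    unfolding D_def
    by (rule MTW_has_derivative[OF assms(1)]) (simp add: w_def interior_preimage[OF z])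
  have "((\<lambda>y. Ji *v (y - b)) has_derivative (\<lambda>h. Ji *v (h - 0))) (at z)"
    by (intro derivative_intros bounded_linear.has_derivative[OF matrix_vector_mul_bounded_linear])
  then have "((\<lambda>y. \<Phi> (Ji *v (y - b))) has_derivative (\<lambda>h. D *v (Ji *v h))) (at z)"
    using has_derivative_compose[of "\<lambda>y. Ji *v (y - b)" "\<lambda>h. Ji *v (h - 0)" z UNIV \<Phi> "\<lambda>h. D *v h"] D
    by (simp add: w_def)
  then have "((\<lambda>y. (1 / det J) *\<^sub>R (J *v \<Phi> (Ji *v (y - b)))) has_derivative
      (\<lambda>h. (1 / det J) *\<^sub>R (J *v (D *v (Ji *v h))))) (at z)"
    by (intro has_derivative_scaleR_right
        bounded_linear.has_derivative[OF matrix_vector_mul_bounded_linear])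
  then have "((\<lambda>y. (1 / det J) *\<^sub>R (J *v \<Phi> (Ji *v (y - b)))) has_derivative
      (\<lambda>h. ((1 / det J) *\<^sub>R (J ** (D ** Ji))) *v h)) (at z)"
    by (simp add: matrix_vector_mul_assoc scaleR_matrix_vector_assoc matrix_mul_assoc)
  then have "(Piola \<Phi> has_derivative (\<lambda>h. ((1 / det J) *\<^sub>R (J ** (D ** Ji))) *v h)) (at z)"
    by (rule has_derivative_transform_within_open[OF _ open_interior z])
      (use interior_subset[of K] in \<open>auto simp: Piola_apply\<close>)
  then have "divergence (Piola \<Phi>) z = trace ((1 / det J) *\<^sub>R (J ** (D ** Ji)))"
    by (rule divergence_eqI)
  also have "\<dots> = (1 / det J) * trace (J ** (D ** Ji))"
    by (simp add: trace_def sum_distrib_left)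
  also have "trace (J ** (D ** Ji)) = trace D"
    by (subst trace_mul_sym) (simp add: matrix_mul_assoc[symmetric] J_inv)
  finally show ?thesis
    by (simp add: divergence_def D_def w_def)
qed

lemma edge_param_map:
  assumes "s \<in> {0..1}"
  shows "edge_param xh k s \<in> Kh" and "F (edge_param xh k s) = edge_param x k s"
proof -
  show in_Kh: "edge_param xh k s \<in> Kh"
    using edge_subset_triangle[of xh k] assms by (auto simp: edge_set_param)
  have lo: "J *v xh (edge_lo k) + b = x (edge_lo k)"
    using F_affine[OF vertex_in] F_vertex by metis
  have "J *v edge_param xh k s + b = (J *v xh (edge_lo k) + b) + s *\<^sub>R edge_vec x k"
    by (simp add: edge_param_def matrix_vector_right_distrib matrix_vector_mult_scaleR edge_vec_map)
  then show "F (edge_param xh k s) = edge_param x k s"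
    unfolding F_affine[OF in_Kh] lo by (simp add: edge_param_def)
qed

lemma edge_preimage:
  assumes "z \<in> edge_set x k"
  shows "Ji *v (z - b) \<in> edge_set xh k"
proof -
  obtain s where s: "s \<in> {0..1}" "z = F (edge_param xh k s)"
    using assms edge_param_map(2)[of _ k] by (auto simp: edge_set_param)
  then have "Ji *v (z - b) = edge_param xh k s"
    using F_affine[OF edge_param_map(1)] by (simp add: J_inv_vec)
  then show ?thesis
    using s(1) by (auto simp: edge_set_param)
qed

text \<open>
  The product of the normal component and the length of the edge is invariant; no absolute
  value of the determinant enters, so orientation-reversing maps need no separate treatment.
\<close>

lemma Piola_rot_edge: "((1 / det J) *\<^sub>R (J *v v)) \<bullet> (rot *v edge_vec x k) = v \<bullet> (rot *v edge_vec xh k)"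
  using rot_piola[of J v "edge_vec xh k"] det_nonzero by (simp add: edge_vec_map)

lemma Piola_MTW:
  assumes \<Phi>: "\<Phi> \<in> MTW xh"
  shows "Piola \<Phi> \<in> MTW x"
proof -
  have poly: "(\<lambda>z. Piola \<Phi> z $ i) \<in> poly_on 3 K" for i
  proof -
    have eq: "Piola \<Phi> z $ i = (\<Sum>l\<in>UNIV. (J $ i $ l / det J) * \<Phi> (Ji *v (z - b)) $ l)"
      if "z \<in> K" for z
      using that by (simp add: Piola_apply matrix_vector_mult_def sum_2 add_divide_distrib)
    have "(\<lambda>z. \<Phi> (Ji *v (z - b)) $ l) \<in> poly_on 3 K" for l
      by (rule poly_on_compose[of "\<lambda>w. \<Phi> w $ l" 3 Kh "\<lambda>z. Ji *v (z - b)"])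
        (use \<Phi> F_inverse(2) in \<open>auto simp: MTW_def poly_on_affine[simplified]\<close>)
    then have "(\<lambda>z. \<Sum>l\<in>UNIV. (J $ i $ l / det J) * \<Phi> (Ji *v (z - b)) $ l) \<in> poly_on 3 K"
      by (intro poly_on_sum poly_on_scale)
    then show ?thesis
      by (subst poly_on_cong[OF eq]) auto
  qed
  have normal: "(\<lambda>z. Piola \<Phi> z \<bullet> normal_vec x k) \<in> poly_on 1 (edge_set x k)" for k
  proof -
    have eq: "Piola \<Phi> z \<bullet> normal_vec x k =
        (norm (edge_vec xh k) / norm (edge_vec x k)) * (\<Phi> (Ji *v (z - b)) \<bullet> normal_vec xh k)"
      if "z \<in> edge_set x k" for z
    proof -
      have "z \<in> K"
        using that edge_subset_triangle by blast
      then show ?thesis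
        using Piola_rot_edge[of "\<Phi> (Ji *v (z - b))" k] edge_vec_nonzero[OF ndh, of k]
        by (simp add: Piola_apply normal_vec_def tangent_def matrix_vector_mult_scaleR)
    qed
    have "(\<lambda>z. \<Phi> (Ji *v (z - b)) \<bullet> normal_vec xh k) \<in> poly_on 1 (edge_set x k)"
      by (rule poly_on_compose[of "\<lambda>w. \<Phi> w \<bullet> normal_vec xh k" 1 "edge_set xh k" "\<lambda>z. Ji *v (z - b)"])
        (use \<Phi> edge_preimage in \<open>auto simp: MTW_def poly_on_affine[simplified]\<close>)
    then have "(\<lambda>z. (norm (edge_vec xh k) / norm (edge_vec x k)) *
        (\<Phi> (Ji *v (z - b)) \<bullet> normal_vec xh k)) \<in> poly_on 1 (edge_set x k)"
      by (rule poly_on_scale)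
    then show ?thesis
      by (subst poly_on_cong[OF eq]) auto
  qed
  obtain a where a: "\<And>w. w \<in> interior Kh \<Longrightarrow> divergence \<Phi> w = a"
    using MTW_divergence_const[OF \<Phi>] by blast
  have "divergence (Piola \<Phi>) z = (1 / det J) * a" if "z \<in> interior K" for z
    using Piola_divergence[OF \<Phi> that] a[OF interior_preimage[OF that]] by simp
  then have "divergence (Piola \<Phi>) \<in> poly_on 0 (interior K)"
    by (subst poly_on_cong[of _ _ "\<lambda>z. (1 / det J) * a"]) (auto intro: poly_on_const)
  with poly normal show ?thesis
    by (simp add: MTW_def piola_def)
qed

end

section \<open>Degrees of freedom as edge moments\<close>

text \<open>
  The common form of all degrees of freedom: the edge vector or its rotation takes the place of \<open>v\<close>,
  unnormalised, which absorbs the length element of the edge.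
\<close>

definition edge_moment ::
    "(3 \<Rightarrow> real^2) \<Rightarrow> 3 \<Rightarrow> real^2 \<Rightarrow> real poly \<Rightarrow> field2 \<Rightarrow> real" where
  "edge_moment x k v q \<Phi> = integral {0..1} (\<lambda>s. (\<Phi> (edge_param x k s) \<bullet> v) * poly q s)"

lemma normal_dof_eq_moment:
  assumes "nondegenerate x"
  shows "normal_dof x \<mu> i k \<Phi> = edge_moment x k (rot *v edge_vec x k) (\<mu> i) \<Phi>"
proof -
  have e: "edge_vec x k \<noteq> 0"
    by (rule edge_vec_nonzero[OF assms])
  then have inj: "inj_on (edge_param x k) {0..1}"
    by (auto simp: inj_on_def edge_param_def)
  show ?thesis
    unfolding normal_dof_def edge_integral_def edge_pullback_def edge_moment_def
    by (intro integral_cong)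
      (use e in \<open>simp add: inv_into_f_f[OF inj] normal_vec_def tangent_def matrix_vector_mult_scaleR\<close>)
qed

lemma tangent_dof_eq_moment:
  assumes "nondegenerate x"
  shows "tangent_dof x k \<Phi> = edge_moment x k (edge_vec x k) 1 \<Phi>"
  unfolding tangent_dof_def edge_integral_def edge_moment_def
  by (intro integral_cong) (use edge_vec_nonzero[OF assms] in \<open>simp add: tangent_def\<close>)

lemma edge_param_in_triangle: "s \<in> {0..1} \<Longrightarrow> edge_param x k s \<in> triangle_of x"
  using edge_subset_triangle[of x k] by (auto simp: edge_set_param)

lemma edge_moment_integrable:
  assumes "\<Phi> \<in> MTW x"
  shows "(\<lambda>s. (\<Phi> (edge_param x k s) \<bullet> v) * poly q s) integrable_on {0..1}"
proof -
  have comp: "continuous_on {0..1} (\<lambda>s. \<Phi> (edge_param x k s) $ i)" for i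
  proof (rule continuous_on_compose2[of "triangle_of x" "\<lambda>z. \<Phi> z $ i"])
    show "continuous_on (triangle_of x) (\<lambda>z. \<Phi> z $ i)"
      using assms by (auto simp: MTW_def intro: poly_on_continuous)
    show "continuous_on {0..1} (edge_param x k)"
      unfolding edge_param_def by (intro continuous_intros)
  qed (use edge_param_in_triangle in auto)
  have "continuous_on {0..1} (\<lambda>s. (\<Phi> (edge_param x k s) \<bullet> v) * poly q s)"
    unfolding inner_vec_def inner_real_def by (intro continuous_intros comp)
  then show ?thesis
    by (rule integrable_continuous_interval)
qed

text \<open>
  This is what splits the tangential degree of freedom of an image field into a normal and a tangential
  one on the reference triangle.
  Membership in the space provides integrability.
\<close>

lemma edge_moment_linear_direction:
  assumes "\<Phi> \<in> MTW x"
  shows "edge_moment x k (a *\<^sub>R v + c *\<^sub>R w) q \<Phi> =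
    a * edge_moment x k v q \<Phi> + c * edge_moment x k w q \<Phi>"
proof -
  have "edge_moment x k (a *\<^sub>R v + c *\<^sub>R w) q \<Phi> =
      integral {0..1} (\<lambda>s. a * ((\<Phi> (edge_param x k s) \<bullet> v) * poly q s) +
        c * ((\<Phi> (edge_param x k s) \<bullet> w) * poly q s))"
    unfolding edge_moment_def
    by (intro integral_cong) (simp add: inner_add_right algebra_simps)
  also have "\<dots> = a * edge_moment x k v q \<Phi> + c * edge_moment x k w q \<Phi>"
    unfolding edge_moment_def
    using edge_moment_integrable[OF assms, of k _ q]
    by (simp add: integral_add integrable_on_mult_right)
  finally show ?thesis .
qed

lemma edge_moment_sum:
  fixes \<Psi> :: "'j::finite \<Rightarrow> field2"
  assumes "\<And>j. \<Psi> j \<in> MTW x"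
  shows "edge_moment x k v q (restrict (\<lambda>z. \<Sum>j\<in>UNIV. c j *\<^sub>R \<Psi> j z) (triangle_of x)) =
    (\<Sum>j\<in>UNIV. c j * edge_moment x k v q (\<Psi> j))"
proof -
  have "edge_moment x k v q (restrict (\<lambda>z. \<Sum>j\<in>UNIV. c j *\<^sub>R \<Psi> j z) (triangle_of x)) =
      integral {0..1} (\<lambda>s. \<Sum>j\<in>UNIV. c j * ((\<Psi> j (edge_param x k s) \<bullet> v) * poly q s))"
    unfolding edge_moment_def
    by (intro integral_cong)
      (simp add: edge_param_in_triangle inner_sum_left sum_distrib_right mult.assoc)
  also have "\<dots> = (\<Sum>j\<in>UNIV. c j * edge_moment x k v q (\<Psi> j))"
    unfolding edge_moment_def
    using edge_moment_integrable[OF assms]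
    by (subst integral_sum) (auto simp: integrable_on_mult_right)
  finally show ?thesis .
qed

lemma dof_sum:
  fixes \<Psi> :: "'j::finite \<Rightarrow> field2"
  assumes "nondegenerate x" and "\<And>j. \<Psi> j \<in> MTW x"
  shows "dof x \<mu> p (restrict (\<lambda>z. \<Sum>j\<in>UNIV. c j *\<^sub>R \<Psi> j z) (triangle_of x)) =
    (\<Sum>j\<in>UNIV. c j * dof x \<mu> p (\<Psi> j))"
proof -
  obtain k i where p: "p = (k, i)" by fastforce
  show ?thesis
    using exhaust_3[of i]
    by (auto simp: p dof_def normal_dof_eq_moment tangent_dof_eq_moment edge_moment_sum assms)
qed

section \<open>Block diagonal matrices\<close>

lemma block_diag_row_sum:
  fixes f :: "'k::finite \<times> 'm::finite \<Rightarrow> real"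
  shows "(\<Sum>q\<in>UNIV. block_diag B $ p $ q * f q) =
    (\<Sum>j\<in>UNIV. B (fst p) $ snd p $ j * f (fst p, j))"
proof -
  have "(\<Sum>q\<in>UNIV. block_diag B $ p $ q * f q) =
      (\<Sum>k\<in>UNIV. \<Sum>j\<in>UNIV. block_diag B $ p $ (k, j) * f (k, j))"
    by (simp add: sum.cartesian_product UNIV_Times_UNIV[symmetric] del: UNIV_Times_UNIV)
  also have "\<dots> = (\<Sum>k\<in>UNIV. if fst p = k then \<Sum>j\<in>UNIV. B (fst p) $ snd p $ j * f (k, j) else 0)"
    by (intro sum.cong refl) (simp add: block_diag_def)
  finally show ?thesis by simp
qed

lemma block_diag_mult: "block_diag A ** block_diag B = block_diag (\<lambda>k. A k ** B k)"
proof -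
  have "(block_diag A ** block_diag B) $ p $ q = block_diag (\<lambda>k. A k ** B k) $ p $ q" for p q
  proof -
    have "(block_diag A ** block_diag B) $ p $ q =
        (\<Sum>r\<in>UNIV. block_diag A $ p $ r * block_diag B $ r $ q)"
      by (simp add: matrix_matrix_mult_def)
    also have "\<dots> = block_diag (\<lambda>k. A k ** B k) $ p $ q"
      unfolding block_diag_row_sum by (simp add: block_diag_def matrix_matrix_mult_def)
    finally show ?thesis .
  qed
  then show ?thesis by (simp add: vec_eq_iff)
qed

lemma block_diag_one: "block_diag (\<lambda>k. mat 1) = mat 1"
  by (auto simp: block_diag_def mat_def vec_eq_iff prod_eq_iff)

lemma lower_block_inverse:
  fixes a c :: real
  assumes "c \<noteq> 0"
  defines "A \<equiv> vector [vector [1, 0, 0], vector [a, c, 0], vector [0, 0, 1]] :: real^3^3"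
    and "B \<equiv> vector [vector [1, 0, 0], vector [- a / c, 1 / c, 0], vector [0, 0, 1]] :: real^3^3"
  shows "A ** B = mat 1" and "B ** A = mat 1"
  using assms(1)
  by (simp_all add: A_def B_def vec_eq_iff forall_3 matrix_matrix_mult_def sum_3 mat_def)

section \<open>Nodal bases\<close>

lemma nodal_basis_mem: "nodal_basis x \<mu> \<Psi> \<Longrightarrow> \<Psi> j \<in> MTW x"
  unfolding nodal_basis_def by blast

lemma nodal_basis_dual: "nodal_basis x \<mu> \<Psi> \<Longrightarrow> dof x \<mu> i (\<Psi> j) = (if i = j then 1 else 0)"
  unfolding nodal_basis_def by blast

text \<open>
  Applying the degrees of freedom to an expansion identifies its coefficients, by duality.
\<close>

lemma nodal_basis_expansion:
  assumes nd: "nondegenerate x" and \<Psi>: "nodal_basis x \<mu> \<Psi>" and \<Phi>: "\<Phi> \<in> MTW x"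
  shows "\<Phi> = restrict (\<lambda>z. \<Sum>j\<in>UNIV. dof x \<mu> j \<Phi> *\<^sub>R \<Psi> j z) (triangle_of x)"
proof -
  obtain c :: "real^(3 \<times> 3)" where
    c: "\<Phi> = restrict (\<lambda>z. \<Sum>j\<in>UNIV. (c $ j) *\<^sub>R \<Psi> j z) (triangle_of x)"
    using \<Psi> \<Phi> unfolding nodal_basis_def by blast
  have "dof x \<mu> i \<Phi> = c $ i" for i
  proof -
    have "dof x \<mu> i \<Phi> = (\<Sum>j\<in>UNIV. c $ j * dof x \<mu> i (\<Psi> j))"
      unfolding c by (intro dof_sum nd nodal_basis_mem[OF \<Psi>])
    also have "\<dots> = c $ i"
      by (simp add: nodal_basis_dual[OF \<Psi>] if_distrib cong: if_cong)
    finally show ?thesis .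
  qed
  then show ?thesis using c by simp
qed

text \<open>
  Two fields with the same degrees of freedom have the same expansion in either basis.
\<close>

lemma nodal_basis_unique:
  assumes nd: "nondegenerate x" and \<Psi>: "nodal_basis x \<mu> \<Psi>" and \<Psi>': "nodal_basis x \<mu> \<Psi>'"
  shows "\<Psi>' = \<Psi>"
proof
  fix i
  have mem: "\<Psi>' i \<in> MTW x" "\<Psi> i \<in> MTW x"
    by (rule nodal_basis_mem[OF \<Psi>'], rule nodal_basis_mem[OF \<Psi>])
  have dofs: "dof x \<mu> j (\<Psi>' i) = dof x \<mu> j (\<Psi> i)" for j
    by (simp add: nodal_basis_dual[OF \<Psi>] nodal_basis_dual[OF \<Psi>'])
  show "\<Psi>' i = \<Psi> i"
    using nodal_basis_expansion[OF nd \<Psi> mem(1)] nodal_basis_expansion[OF nd \<Psi> mem(2)]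
    unfolding dofs by simp
qed

lemma nodal_basisI:
  assumes nd: "nondegenerate x" and mem: "\<And>j. \<Psi> j \<in> MTW x"
    and dual: "\<And>i j. dof x \<mu> i (\<Psi> j) = (if i = j then 1 else 0)"
    and expand: "\<And>\<Phi>. \<Phi> \<in> MTW x \<Longrightarrow>
      \<Phi> = restrict (\<lambda>z. \<Sum>j\<in>UNIV. dof x \<mu> j \<Phi> *\<^sub>R \<Psi> j z) (triangle_of x)"
  shows "nodal_basis x \<mu> \<Psi>"
  unfolding nodal_basis_def
proof (intro conjI ballI allI)
  fix \<Phi> assume \<Phi>: "\<Phi> \<in> MTW x"
  show "\<exists>!c :: real^(3 \<times> 3).
      \<Phi> = restrict (\<lambda>z. \<Sum>j\<in>UNIV. (c $ j) *\<^sub>R \<Psi> j z) (triangle_of x)"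
  proof (rule ex1I[of _ "\<chi> j. dof x \<mu> j \<Phi>"])
    show "\<Phi> = restrict (\<lambda>z. \<Sum>j\<in>UNIV. ((\<chi> j. dof x \<mu> j \<Phi>) $ j) *\<^sub>R \<Psi> j z) (triangle_of x)"
      using expand[OF \<Phi>] by simp
  next
    fix c :: "real^(3 \<times> 3)"
    assume c: "\<Phi> = restrict (\<lambda>z. \<Sum>j\<in>UNIV. (c $ j) *\<^sub>R \<Psi> j z) (triangle_of x)"
    have "dof x \<mu> i \<Phi> = c $ i" for i
      unfolding c dof_sum[of x \<Psi>, OF nd mem] by (simp add: dual if_distrib cong: if_cong)
    then show "c = (\<chi> j. dof x \<mu> j \<Phi>)"
      by (simp add: vec_eq_iff)
  qed
qed (use mem dual in auto)

section \<open>Transformation of degrees of freedom and nodal bases\<close>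

context affine_triangle_map
begin

abbreviation "W \<equiv> block_diag (W_block xh J)"
abbreviation "P \<equiv> P_mat xh J"

text \<open>
  The Piola map commutes with the edge parametrisations, so its matrix can be moved from the field to the
  direction.  Here \<open>v v* J\<close> is \<open>J\<^sup>T v\<close>.
\<close>

lemma edge_moment_Piola:
  "edge_moment x k v q (Piola \<Phi>) = edge_moment xh k ((1 / det J) *\<^sub>R (v v* J)) q \<Phi>"
  unfolding edge_moment_def
proof (intro integral_cong)
  fix s :: real assume "s \<in> {0..1}"
  then have "Piola \<Phi> (edge_param x k s) = (1 / det J) *\<^sub>R (J *v \<Phi> (edge_param xh k s))"
    using Piola_at_image[OF edge_param_map(1)] edge_param_map(2) by metis
  moreover have "(J *v \<Phi> (edge_param xh k s)) \<bullet> v = \<Phi> (edge_param xh k s) \<bullet> (v v* J)"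
    by (metis dot_lmul_matrix inner_commute)
  ultimately show "Piola \<Phi> (edge_param x k s) \<bullet> v * poly q s =
      \<Phi> (edge_param xh k s) \<bullet> ((1 / det J) *\<^sub>R (v v* J)) * poly q s"
    by simp
qed

lemma normal_direction: "(1 / det J) *\<^sub>R ((rot *v edge_vec x k) v* J) = rot *v edge_vec xh k"
proof -
  have "v \<bullet> ((1 / det J) *\<^sub>R ((rot *v edge_vec x k) v* J)) = v \<bullet> (rot *v edge_vec xh k)" for v
    using Piola_rot_edge[of v k] dot_lmul_matrix[of "rot *v edge_vec x k" J v]
    by (simp add: inner_commute)
  then show ?thesis
    using vector_eq_ldot by blast
qed

text \<open>
  The coefficients are stated with unit vectors; clearing the normalisation exhibits them as the
  coordinates of \<open>J\<^sup>T e / det J\<close> in the orthogonal basis of rotated reference edge and reference edge,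
  and shows that \<open>\<beta>\<close> does not vanish.
\<close>

lemma edge_coeffs_eq:
  "alpha xh J k = (edge_vec x k v* J) \<bullet> (rot *v edge_vec xh k) / (det J * (edge_vec xh k \<bullet> edge_vec xh k))"
  "beta xh J k = (edge_vec x k \<bullet> edge_vec x k) / (det J * (edge_vec xh k \<bullet> edge_vec xh k))"
proof -
  let ?e = "edge_vec xh k"
  have th: "(transpose J ** J) *v tangent xh k = (1 / norm ?e) *\<^sub>R (edge_vec x k v* J)"
    by (simp add: tangent_def matrix_vector_mult_scaleR edge_vec_map
        matrix_vector_mul_assoc[symmetric])
  have "edge_coeffs xh J k = (1 / det J) *\<^sub>R
      ((vector [normal_vec xh k, tangent xh k] :: real^2^2) *v ((1 / norm ?e) *\<^sub>R (edge_vec x k v* J)))"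
    unfolding edge_coeffs_def th[symmetric]
    by (simp only: matrix_vector_mul_assoc matrix_mul_assoc)
  then have comps: "alpha xh J k = (1 / det J) * (normal_vec xh k \<bullet> ((1 / norm ?e) *\<^sub>R (edge_vec x k v* J)))"
      "beta xh J k = (1 / det J) * (tangent xh k \<bullet> ((1 / norm ?e) *\<^sub>R (edge_vec x k v* J)))"
    by (simp_all add: alpha_def beta_def matrix_vector_mult_def inner_vec_def)
  show "alpha xh J k = (edge_vec x k v* J) \<bullet> (rot *v ?e) / (det J * (?e \<bullet> ?e))"
    unfolding comps
    by (simp add: normal_vec_def tangent_def matrix_vector_mult_scaleR inner_commute
        dot_square_norm power2_eq_square)
  have "?e \<bullet> (edge_vec x k v* J) = edge_vec x k \<bullet> edge_vec x k"
    using dot_lmul_matrix[of "edge_vec x k" J ?e] by (simp add: inner_commute edge_vec_map)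
  then show "beta xh J k = (edge_vec x k \<bullet> edge_vec x k) / (det J * (?e \<bullet> ?e))"
    unfolding comps by (simp add: tangent_def dot_square_norm power2_eq_square)
qed

lemma beta_nonzero: "beta xh J k \<noteq> 0"
  using edge_vec_nonzero[OF nd] edge_vec_nonzero[OF ndh] det_nonzero by (simp add: edge_coeffs_eq)

lemma tangent_direction:
  "(1 / det J) *\<^sub>R (edge_vec x k v* J) =
    alpha xh J k *\<^sub>R (rot *v edge_vec xh k) + beta xh J k *\<^sub>R edge_vec xh k"
proof -
  let ?e = "edge_vec xh k" and ?v = "edge_vec x k v* J"
  have e: "?e \<bullet> ?e \<noteq> 0"
    using edge_vec_nonzero[OF ndh] by simp
  have ve: "?v \<bullet> ?e = edge_vec x k \<bullet> edge_vec x k"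
    using dot_lmul_matrix[of "edge_vec x k" J ?e] by (simp add: edge_vec_map)
  have "(1 / det J) *\<^sub>R ?v = (1 / (det J * (?e \<bullet> ?e))) *\<^sub>R ((?e \<bullet> ?e) *\<^sub>R ?v)"
    using e by simp
  also have "\<dots> = alpha xh J k *\<^sub>R (rot *v ?e) + beta xh J k *\<^sub>R ?e"
    unfolding rot_decomposition[of ?e ?v]
    by (simp add: edge_coeffs_eq ve scaleR_add_right add.commute)
  finally show ?thesis .
qed

lemma normal_dof_Piola: "normal_dof x \<mu> i k (Piola \<Phi>) = normal_dof xh \<mu> i k \<Phi>"
  by (simp add: normal_dof_eq_moment nd ndh edge_moment_Piola normal_direction)

lemma tangent_dof_Piola:
  assumes "\<Phi> \<in> MTW xh" and "\<mu> 0 = 1"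
  shows "tangent_dof x k (Piola \<Phi>) =
    alpha xh J k * normal_dof xh \<mu> 0 k \<Phi> + beta xh J k * tangent_dof xh k \<Phi>"
  by (simp add: normal_dof_eq_moment tangent_dof_eq_moment nd ndh edge_moment_Piola
      tangent_direction edge_moment_linear_direction[OF assms(1)] assms(2))

lemma dof_Piola:
  assumes "\<Phi> \<in> MTW xh" and "\<mu> 0 = 1"
  shows "(\<chi> p. dof x \<mu> p (Piola \<Phi>)) = W *v (\<chi> p. dof xh \<mu> p \<Phi>)"
proof -
  have "dof x \<mu> (k, i) (Piola \<Phi>) = (W *v (\<chi> p. dof xh \<mu> p \<Phi>)) $ (k, i)" for k i
  proof -
    have "(W *v (\<chi> p. dof xh \<mu> p \<Phi>)) $ (k, i) =
        (\<Sum>j\<in>UNIV. W_block xh J k $ i $ j * dof xh \<mu> (k, j) \<Phi>)"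
      by (simp add: matrix_vector_mult_def block_diag_row_sum)
    then show ?thesis
      using exhaust_3[of i]
      by (auto simp: dof_def sum_3 W_block_def normal_dof_Piola tangent_dof_Piola[of \<Phi> \<mu>, OF assms])
  qed
  then show ?thesis
    by (simp add: vec_eq_iff split_paired_all)
qed

lemma W_block_inverse:
  "W_block xh J k ** matrix_inv (W_block xh J k) = mat 1"
  "matrix_inv (W_block xh J k) ** W_block xh J k = mat 1"
  "matrix_inv (W_block xh J k) = vector
     [vector [1, 0, 0],
      vector [- alpha xh J k / beta xh J k, 1 / beta xh J k, 0],
      vector [0, 0, 1]]"
proof -
  note inv = lower_block_inverse[OF beta_nonzero, of "alpha xh J k" k, folded W_block_def]
  show eq: "matrix_inv (W_block xh J k) = vector
     [vector [1, 0, 0],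
      vector [- alpha xh J k / beta xh J k, 1 / beta xh J k, 0],
      vector [0, 0, 1]]"
    by (rule matrix_inv_eqI[OF inv])
  show "W_block xh J k ** matrix_inv (W_block xh J k) = mat 1"
    "matrix_inv (W_block xh J k) ** W_block xh J k = mat 1"
    unfolding eq by (rule inv)+
qed

lemma P_W_inverse: "P ** W = mat 1" "W ** P = mat 1"
  by (simp_all add: P_mat_def block_diag_mult W_block_inverse(1,2) block_diag_one)

lemma dof_reference:
  assumes "\<Phi> \<in> MTW xh" and "\<mu> 0 = 1"
  shows "(\<chi> p. dof xh \<mu> p \<Phi>) = P *v (\<chi> p. dof x \<mu> p (Piola \<Phi>))"
  by (simp add: dof_Piola[of \<Phi> \<mu>, OF assms] matrix_vector_mul_assoc P_W_inverse)

text \<open>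
  Duality is the identity \<open>W P = 1\<close>.  Completeness comes from the inverse Piola map: a field on \<open>K\<close>
  is the image of a reference field, whose coefficients in the reference basis are \<open>P\<close> applied to its
  degrees of freedom on \<open>K\<close>.
\<close>

lemma nodal_basis_Piola:
  assumes \<Psi>h: "nodal_basis xh \<mu> \<Psi>h" and \<mu>: "\<mu> 0 = 1"
  shows "nodal_basis x \<mu> (mat_fields K (transpose P) (\<lambda>j. Piola (\<Psi>h j)))"
    (is "nodal_basis x \<mu> ?\<Psi>")
proof (rule nodal_basisI[OF nd])
  have mem_h: "\<Psi>h j \<in> MTW xh" for j
    by (rule nodal_basis_mem[OF \<Psi>h])
  have mem: "Piola (\<Psi>h j) \<in> MTW x" for j
    by (rule Piola_MTW[OF mem_h])
  show "?\<Psi> m \<in> MTW x" for m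
    unfolding mat_fields_def by (rule MTW_linear_combination[OF mem])
  show "dof x \<mu> i (?\<Psi> m) = (if i = m then 1 else 0)" for i m
  proof -
    have "dof x \<mu> i (Piola (\<Psi>h j)) = W $ i $ j" for j
    proof -
      have "dof x \<mu> i (Piola (\<Psi>h j)) = (W *v (\<chi> p. dof xh \<mu> p (\<Psi>h j))) $ i"
        by (simp add: dof_Piola[of _ \<mu>, OF mem_h \<mu>, symmetric])
      also have "\<dots> = W $ i $ j"
        by (simp add: matrix_vector_mult_def nodal_basis_dual[OF \<Psi>h] if_distrib cong: if_cong)
      finally show ?thesis .
    qed
    then have "dof x \<mu> i (?\<Psi> m) = (\<Sum>j\<in>UNIV. P $ j $ m * W $ i $ j)"
      unfolding mat_fields_def
      by (subst dof_sum[OF nd mem]) (simp add: transpose_def)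
    also have "\<dots> = (W ** P) $ i $ m"
      by (simp add: matrix_matrix_mult_def mult.commute)
    also have "\<dots> = (if i = m then 1 else 0)"
      by (simp add: P_W_inverse mat_def)
    finally show ?thesis .
  qed
  fix \<Phi> assume \<Phi>: "\<Phi> \<in> MTW x"
  interpret R: affine_triangle_map "inv_into Kh F" Ji "- (Ji *v b)" x xh
    by (rule reverse)
  define \<Theta> where "\<Theta> = R.Piola \<Phi>"
  have \<Theta>: "\<Theta> \<in> MTW xh"
    unfolding \<Theta>_def by (rule R.Piola_MTW[OF \<Phi>])
  have \<Phi>_eq: "\<Phi> = Piola \<Theta>"
    using \<Phi> unfolding \<Theta>_def by (subst Piola_reverse) (auto simp: MTW_def)
  have coeff: "dof xh \<mu> j \<Theta> = (\<Sum>m\<in>UNIV. P $ j $ m * dof x \<mu> m \<Phi>)" for j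
    using arg_cong[OF dof_reference[of \<Theta> \<mu>, OF \<Theta> \<mu>], of "\<lambda>v. v $ j"]
    by (simp add: \<Phi>_eq matrix_vector_mult_def)
  have "\<Phi> = Piola (restrict (\<lambda>w. \<Sum>j\<in>UNIV. dof xh \<mu> j \<Theta> *\<^sub>R \<Psi>h j w) Kh)"
    unfolding \<Phi>_eq using nodal_basis_expansion[OF ndh \<Psi>h \<Theta>] by (rule arg_cong)
  also have "\<dots> = restrict (\<lambda>z. \<Sum>j\<in>UNIV. dof xh \<mu> j \<Theta> *\<^sub>R Piola (\<Psi>h j) z) K"
    by (rule Piola_sum)
  also have "\<dots> = restrict (\<lambda>z. \<Sum>m\<in>UNIV. dof x \<mu> m \<Phi> *\<^sub>R ?\<Psi> m z) K"
  proof (rule restrict_ext)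
    fix z assume z: "z \<in> K"
    have "(\<Sum>j\<in>UNIV. dof xh \<mu> j \<Theta> *\<^sub>R Piola (\<Psi>h j) z) =
        (\<Sum>j\<in>UNIV. \<Sum>m\<in>UNIV. (P $ j $ m * dof x \<mu> m \<Phi>) *\<^sub>R Piola (\<Psi>h j) z)"
      by (simp add: coeff scaleR_sum_left)
    also have "\<dots> = (\<Sum>m\<in>UNIV. \<Sum>j\<in>UNIV. (P $ j $ m * dof x \<mu> m \<Phi>) *\<^sub>R Piola (\<Psi>h j) z)"
      by (rule sum.swap)
    also have "\<dots> = (\<Sum>m\<in>UNIV. dof x \<mu> m \<Phi> *\<^sub>R ?\<Psi> m z)"
      using z by (simp add: mat_fields_def transpose_def scaleR_sum_right mult.commute)
    finally show "(\<Sum>j\<in>UNIV. dof xh \<mu> j \<Theta> *\<^sub>R Piola (\<Psi>h j) z) =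
        (\<Sum>m\<in>UNIV. dof x \<mu> m \<Phi> *\<^sub>R ?\<Psi> m z)" .
  qed
  finally show "\<Phi> = restrict (\<lambda>z. \<Sum>m\<in>UNIV. dof x \<mu> m \<Phi> *\<^sub>R ?\<Psi> m z) K" .
qed

end

theorem mainTheorem1:
  fixes F :: "real^2 \<Rightarrow> real^2" and J :: "real^2^2" and b :: "real^2"
    and xh x :: "3 \<Rightarrow> real^2" and \<mu> :: "nat \<Rightarrow> real poly"
  assumes "nondegenerate xh" and "nondegenerate x"
    and "bij_betw F (triangle_of xh) (triangle_of x)"
    and "\<forall>z\<in>triangle_of xh. F z = J *v z + b"
    and "\<forall>i. F (xh i) = x i"
    and "\<mu> 0 = 1" and "P1_basis \<mu>"
  shows
    "(\<forall>\<Phi>\<in>MTW xh. piola F J (triangle_of xh) (triangle_of x) \<Phi> \<in> MTW x) \<and>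
     (\<forall>\<Phi>\<in>MTW xh.
        (\<chi> i. pushforward F J (triangle_of xh) (triangle_of x) (dof x \<mu> i) \<Phi>)
          = block_diag (W_block xh J) *v (\<chi> i. dof xh \<mu> i \<Phi>)) \<and>
     (\<forall>k. beta xh J k \<noteq> 0 \<and> invertible (W_block xh J k) \<and>
        matrix_inv (W_block xh J k) = vector
          [vector [1, 0, 0],
           vector [- alpha xh J k / beta xh J k, 1 / beta xh J k, 0],
           vector [0, 0, 1]]) \<and>
     (\<forall>\<Phi>\<in>MTW xh.
        (\<chi> i. dof xh \<mu> i \<Phi>)
          = P_mat xh J *v
              (\<chi> i. pushforward F J (triangle_of xh) (triangle_of x) (dof x \<mu> i) \<Phi>)) \<and>
     (\<forall>\<Psi>h \<Psi>. nodal_basis xh \<mu> \<Psi>h \<longrightarrow>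
        (nodal_basis x \<mu> \<Psi> \<longleftrightarrow>
         \<Psi> = mat_fields (triangle_of x) (transpose (P_mat xh J))
                (\<lambda>j. piola F J (triangle_of xh) (triangle_of x) (\<Psi>h j))))"
proof -
  interpret affine_triangle_map F J b xh x
    by standard (use assms in auto)
  show ?thesis
  proof (intro conjI ballI allI impI)
    show "Piola \<Phi> \<in> MTW x" if "\<Phi> \<in> MTW xh" for \<Phi>
      by (rule Piola_MTW[OF that])
    show "(\<chi> i. pushforward F J Kh K (dof x \<mu> i) \<Phi>) = W *v (\<chi> i. dof xh \<mu> i \<Phi>)"
      if "\<Phi> \<in> MTW xh" for \<Phi>
      using dof_Piola[of \<Phi> \<mu>, OF that assms(6)] by (simp add: pushforward_def)
    show "beta xh J k \<noteq> 0" for k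
      by (rule beta_nonzero)
    show "invertible (W_block xh J k)" for k
      using W_block_inverse(1,2) by (auto simp: invertible_def)
    show "matrix_inv (W_block xh J k) = vector
          [vector [1, 0, 0],
           vector [- alpha xh J k / beta xh J k, 1 / beta xh J k, 0],
           vector [0, 0, 1]]" for k
      by (rule W_block_inverse(3))
    show "(\<chi> i. dof xh \<mu> i \<Phi>) = P *v (\<chi> i. pushforward F J Kh K (dof x \<mu> i) \<Phi>)"
      if "\<Phi> \<in> MTW xh" for \<Phi>
      using dof_reference[of \<Phi> \<mu>, OF that assms(6)] by (simp add: pushforward_def)
    show "nodal_basis x \<mu> \<Psi> \<longleftrightarrow> \<Psi> = mat_fields K (transpose P) (\<lambda>j. Piola (\<Psi>h j))"
      if "nodal_basis xh \<mu> \<Psi>h" for \<Psi>h \<Psi>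
      using nodal_basis_Piola[OF that assms(6)] nodal_basis_unique[OF assms(2)] by blast
  qed
qed

end
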